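(* Let $(\mathcal{R},\leq,r)$ be a topological Ramsey space and $\mathcal{H}\subseteq\mathcal{R}$ a selective coideal. Then every metric open subset of $\mathcal{R}$ is $\mathcal{H}$-Ramsey.
   Context: A triple $(\mathcal{R},\leq,r)$ consists of a set $\mathcal{R}$, a quasi order $\leq$ on $\mathcal{R}$ and a function $r:\mathbb{N}\times\mathcal{R}\to\mathcal{AR}$ with range $\mathcal{AR}$; write $r_n(A)=r(n,A)$ and $\mathcal{AR}_n=\{r_n(A):A\in\mathcal{R}\}$. Assume: (A.1) $r_0(A)=\emptyset$ for all $A$; (A.2) if $A\neq B$ then $r_n(A)\neq r_n(B)$ for some $n$; (A.3) if $r_n(A)=r_m(B)$ then $n=m$ and $r_i(A)=r_i(B)$ for all $i<n$. For $a\in\mathcal{AR}$, $|a|$ is the unique $n$ with $a=r_n(A)$ for some $A$. For $a\in\mathcal{AR}$, $A\in\mathcal{R}$ let $[a,A]=\{B\in\mathcal{R}:\exists n\,(r_n(B)=a)\text{ and }B\leq A\}$; $a$ is compatible with $A$ if $[a,A]\neq\emptyset$; $\mathcal{AR}(A)$ is the set of $a$ compatible with $A$; $[n,A]=[r_n(A),A]$; $r_{k}([a,B])=\{r_k(C):C\in[a,B]\}$. Identifying $A$ with $(r_n(A))_n$, $\mathcal{R}$ is a subspace of $\mathcal{AR}^{\mathbb{N}}$ ($\mathcal{AR}$ discrete, product topology); $\mathcal{R}$ is metrically closed if it is closed there. The metric open subsets of $\mathcal{R}$ are the open sets of this subspace topology, i.e. unions of sets $[b]=\{A\in\mathcal{R}:\exists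 n\,(r_n(A)=b)\}$, $b\in\mathcal{AR}$. (A.4) There is a quasi order $\leq_{fin}$ on $\mathcal{AR}$ with: $A\leq B$ iff $\forall n\exists m\ r_n(A)\leq_{fin}r_m(B)$; and $\{b:b\leq_{fin}a\}$ is finite for each $a$. $depth_A(a)$ is the least $n$ with $a\leq_{fin}r_n(A)$. (A.5) For compatible $a,A$ with $depth_A(a)=n$: (i) $[a,B]\neq\emptyset$ for all $B\in[n,A]$; (ii) for all $B\in[a,A]$ there is $A'\in[n,A]$ with $[a,A']\subseteq[a,B]$. (A.6) For compatible $a,A$ with $depth_A(a)=n$ and any $\phi:\mathcal{AR}_{|a|+1}\to\{0,1\}$ there is $B\in[n,A]$ with $\phi$ constant on $r_{|a|+1}([a,B])$. A topological Ramsey space is such a triple satisfying (A.1)–(A.6) with $\mathcal{R}$ metrically closed. For $\mathcal{H}\subseteq\mathcal{R}$ and $A\in\mathcal{R}$, $\mathcal{H}\!\upharpoonright\! A=\{B\in\mathcal{H}:B\leq A\}$. $\mathcal{H}$ is a coideal if: (1) $A\leq B$, $A\in\mathcal{H}$ imply $B\in\mathcal{H}$; (2) for $A\in\mathcal{H}$, $a\in\mathcal{AR}(A)$, $n=depth_A(a)$: (i) for all $B\in[n,A]\cap\mathcal{H}$, $[a,B]\cap\mathcal{H}\neq\emptyset$; (ii) for all $B\in[a,A]\cap\mathcal{H}$ there is $A'\in[n,A]\cap\mathcal{H}$ with $[a,A']\subseteq[a,B]$; (3) for $a\in\mathcal{AR}$ of length $l$, $\mathcal{O}\subseteq\mathcal{AR}_{l+1}$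 and every $A\in\mathcal{H}$ with $[a,A]\neq\emptyset$ there is $B\in[depth_A(a),A]\cap\mathcal{H}$ with $r_{l+1}([a,B])\subseteq\mathcal{O}$ or $r_{l+1}([a,B])\subseteq\mathcal{AR}_{l+1}\setminus\mathcal{O}$. A coideal $\mathcal{H}$ is selective if for every $A\in\mathcal{H}$, $\mathcal{I}\subseteq\mathcal{AR}$ and family $(A_a)_{a\in\mathcal{I}}$ with $A_a\in\mathcal{H}\!\upharpoonright\! A$ and $[a,A_a]\neq\emptyset$, there is $B\in\mathcal{H}\!\upharpoonright\! A$ with $[a,B]\subseteq[a,A_a]$ for all $a\in\mathcal{I}\cap\mathcal{AR}(B)$. $\mathcal{X}\subseteq\mathcal{R}$ is $\mathcal{H}$-Ramsey if for every $[a,A]\neq\emptyset$ with $A\in\mathcal{H}$ there exists $B\in[a,A]\cap\mathcal{H}$ with $[a,B]\neq\emptyset$ such that $[a,B]\subseteq\mathcal{X}$ or $[a,B]\subseteq\mathcal{R}\setminus\mathcal{X}$. *)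

theory Defs
  imports "HOL-Analysis.Analysis"
begin

text \<open>
  The set \<open>\<R>\<close> is a carrier \<open>R\<close>, and \<open>r n A\<close> is the \<open>n\<close>-th approximation of \<open>A\<close>.  The finitary
  quasi order \<open>lefin\<close> is a parameter rather than an existentially quantified witness, because the
  depth function, and hence the notion of a coideal, refers to it.
\<close>

locale ramsey_triple =
  fixes R :: "'r set"
    and le :: "'r \<Rightarrow> 'r \<Rightarrow> bool"  (infix \<open>\<preceq>\<close> 50)
    and r :: "nat \<Rightarrow> 'r \<Rightarrow> 'a"
    and lefin :: "'a \<Rightarrow> 'a \<Rightarrow> bool"  (infix \<open>\<preceq>\<^sub>f\<close> 50)
begin

definition AR :: "'a set" where
  "AR = {r n A |n A. A \<in> R}"

definition AR_level :: "nat \<Rightarrow> 'a set" where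
  "AR_level n = {r n A |A. A \<in> R}"

definition len :: "'a \<Rightarrow> nat" where
  "len a = (THE n. \<exists>A\<in>R. a = r n A)"

definition basic :: "'a \<Rightarrow> 'r \<Rightarrow> 'r set" where
  "basic a A = {B \<in> R. (\<exists>n. r n B = a) \<and> B \<preceq> A}"

definition basic_nat :: "nat \<Rightarrow> 'r \<Rightarrow> 'r set" where
  "basic_nat n A = basic (r n A) A"

definition compatible :: "'a \<Rightarrow> 'r \<Rightarrow> bool" where
  "compatible a A \<longleftrightarrow> basic a A \<noteq> {}"

definition AR_below :: "'r \<Rightarrow> 'a set" where
  "AR_below A = {a \<in> AR. compatible a A}"

definition depth :: "'r \<Rightarrow> 'a \<Rightarrow> nat" where
  "depth A a = (LEAST n. a \<preceq>\<^sub>f r n A)"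

definition approx_topology :: "(nat \<Rightarrow> 'a) topology" where
  "approx_topology = product_topology (\<lambda>_. discrete_topology AR) UNIV"

text \<open>Identification of \<open>A\<close> with the sequence of its approximations.\<close>

definition approx_seq :: "'r \<Rightarrow> nat \<Rightarrow> 'a" where
  "approx_seq A = (\<lambda>n. r n A)"

definition metrically_closed :: bool where
  "metrically_closed \<longleftrightarrow> closedin approx_topology (approx_seq ` R)"

text \<open>The subspace topology, transported to \<open>R\<close> along the identification.\<close>

definition metric_topology :: "'r topology" where
  "metric_topology = pullback_topology R approx_seq approx_topology"

definition metric_open :: "'r set \<Rightarrow> bool" where
  "metric_open X \<longleftrightarrow> openin metric_topology X"

definition restr :: "'r set \<Rightarrow> 'r \<Rightarrow> 'r set" where
  "restr H A = {B \<in> H. B \<preceq> A}"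

definition coideal :: "'r set \<Rightarrow> bool" where
  "coideal H \<longleftrightarrow>
     H \<subseteq> R \<and>
     (\<forall>A\<in>R. \<forall>B\<in>R. A \<preceq> B \<longrightarrow> A \<in> H \<longrightarrow> B \<in> H) \<and>
     (\<forall>A\<in>H. \<forall>a\<in>AR_below A.
        (\<forall>B \<in> basic_nat (depth A a) A \<inter> H. basic a B \<inter> H \<noteq> {}) \<and>
        (\<forall>B \<in> basic a A \<inter> H. \<exists>A' \<in> basic_nat (depth A a) A \<inter> H. basic a A' \<subseteq> basic a B)) \<and>
     (\<forall>a\<in>AR. \<forall>Q \<subseteq> AR_level (len a + 1). \<forall>A\<in>H. basic a A \<noteq> {} \<longrightarrow>
        (\<exists>B \<in> basic_nat (depth A a) A \<inter> H.
           r (len a + 1) ` basic a B \<subseteq> Q \<or>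
           r (len a + 1) ` basic a B \<subseteq> AR_level (len a + 1) - Q))"

definition selective :: "'r set \<Rightarrow> bool" where
  "selective H \<longleftrightarrow>
     (\<forall>A\<in>H. \<forall>I \<subseteq> AR. \<forall>F :: 'a \<Rightarrow> 'r.
        (\<forall>a\<in>I. F a \<in> restr H A \<and> basic a (F a) \<noteq> {}) \<longrightarrow>
        (\<exists>B \<in> restr H A. \<forall>a \<in> I \<inter> AR_below B. basic a B \<subseteq> basic a (F a)))"

definition selective_coideal :: "'r set \<Rightarrow> bool" where
  "selective_coideal H \<longleftrightarrow> coideal H \<and> selective H"

definition H_Ramsey :: "'r set \<Rightarrow> 'r set \<Rightarrow> bool" where
  "H_Ramsey H X \<longleftrightarrow>
     (\<forall>a\<in>AR. \<forall>A\<in>H. basic a A \<noteq> {} \<longrightarrow>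
        (\<exists>B \<in> basic a A \<inter> H. basic a B \<noteq> {} \<and> (basic a B \<subseteq> X \<or> basic a B \<subseteq> R - X)))"

end

text \<open>The parameter \<open>emp\<close> is the common value of all \<open>0\<close>-th approximations, written
  \<open>\<emptyset>\<close> in the literature.\<close>

locale topological_Ramsey_space = ramsey_triple R le r lefin
  for R :: "'r set"
    and le :: "'r \<Rightarrow> 'r \<Rightarrow> bool"  (infix \<open>\<preceq>\<close> 50)
    and r :: "nat \<Rightarrow> 'r \<Rightarrow> 'a"
    and lefin :: "'a \<Rightarrow> 'a \<Rightarrow> bool"  (infix \<open>\<preceq>\<^sub>f\<close> 50) +
  fixes emp :: 'a
  assumes le_quasi_order: "reflp_on R (\<preceq>)" "transp_on R (\<preceq>)"
    and A1: "A \<in> R \<Longrightarrow> r 0 A = emp"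
    and A2: "\<lbrakk>A \<in> R; B \<in> R; A \<noteq> B\<rbrakk> \<Longrightarrow> \<exists>n. r n A \<noteq> r n B"
    and A3: "\<lbrakk>A \<in> R; B \<in> R; r n A = r m B\<rbrakk> \<Longrightarrow> n = m \<and> (\<forall>i<n. r i A = r i B)"
    and lefin_quasi_order: "reflp_on AR (\<preceq>\<^sub>f)" "transp_on AR (\<preceq>\<^sub>f)"
    and A4_le: "\<lbrakk>A \<in> R; B \<in> R\<rbrakk> \<Longrightarrow> A \<preceq> B \<longleftrightarrow> (\<forall>n. \<exists>m. r n A \<preceq>\<^sub>f r m B)"
    and A4_finite: "a \<in> AR \<Longrightarrow> finite {b \<in> AR. b \<preceq>\<^sub>f a}"
    and A5_i: "\<lbrakk>a \<in> AR; A \<in> R; compatible a A; B \<in> basic_nat (depth A a) A\<rbrakk>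
        \<Longrightarrow> basic a B \<noteq> {}"
    and A5_ii: "\<lbrakk>a \<in> AR; A \<in> R; compatible a A; B \<in> basic a A\<rbrakk>
        \<Longrightarrow> \<exists>A' \<in> basic_nat (depth A a) A. basic a A' \<subseteq> basic a B"
    and A6: "\<And>a A (\<phi> :: 'a \<Rightarrow> bool). \<lbrakk>a \<in> AR; A \<in> R; compatible a A\<rbrakk>
        \<Longrightarrow> \<exists>B \<in> basic_nat (depth A a) A. \<exists>c. \<forall>b \<in> r (len a + 1) ` basic a B. \<phi> b = c"
    and closed: "metrically_closed"

end

theory Submission
  imports Defs
begin

text \<open>
  Selectivity yields a diagonalisation \<open>D \<in> H\<close> with \<open>D \<preceq> A\<close>, but nothing makes \<open>D\<close> compatible with
  the given \<open>a\<close>, so the usual fusion argument cannot be run inside \<open>D\<close>. Instead, \<open>D\<close> steers a fusion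
  of members of \<open>H\<close> that starts from \<open>A\<close>: the family to be diagonalised is chosen so that the
  approximations of \<open>D\<close> determine a sequence \<open>C\<^sub>0 = A, C\<^sub>1, C\<^sub>2, \<dots>\<close> with \<open>C\<^sub>n\<^sub>+\<^sub>1 \<in> [M\<^sub>n, C\<^sub>n]\<close>,
  each \<open>C\<^sub>n\<close> treating all levels below \<open>M\<^sub>n\<close>, in which every approximation of \<open>D\<close> has been absorbed
  by some stage. The limit \<open>B\<close> then satisfies \<open>D \<preceq> B\<close>, hence \<open>B \<in> H\<close> because \<open>H\<close> is upward
  closed, and \<open>B\<close> agrees with \<open>A\<close> up to a prescribed level.

  Two such fusions give a \<open>B\<close> in which every approximation of large depth is accepted or rejected
  and successors of rejected ones are rejected. The finitely many approximations of small depth are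
  then avoided by finitely many applications of the pigeonhole principle for \<open>H\<close>.
\<close>

section \<open>Approximations, depth and limits\<close>

context topological_Ramsey_space
begin

lemma r_in_AR [simp, intro]: "A \<in> R \<Longrightarrow> r n A \<in> AR"
  unfolding AR_def by blast

lemma len_r [simp]: "A \<in> R \<Longrightarrow> len (r n A) = n"
  unfolding len_def by (rule the_equality) (use A3 in blast)+

lemma le_refl: "A \<in> R \<Longrightarrow> A \<preceq> A"
  using le_quasi_order(1) by (auto simp: reflp_on_def)

lemma le_trans: "A \<preceq> B \<Longrightarrow> B \<preceq> C \<Longrightarrow> A \<in> R \<Longrightarrow> B \<in> R \<Longrightarrow> C \<in> R \<Longrightarrow> A \<preceq> C"
  using le_quasi_order(2) unfolding transp_on_def by blast

lemma r_eq_mono: "r n A = r n B \<Longrightarrow> i \<le> n \<Longrightarrow> A \<in> R \<Longrightarrow> B \<in> R \<Longrightarrow> r i A = r i B"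
  using A3 by (metis le_neq_implies_less)

lemma basic_iff: "a \<in> AR \<Longrightarrow> B \<in> basic a A \<longleftrightarrow> B \<in> R \<and> r (len a) B = a \<and> B \<preceq> A"
  unfolding basic_def by auto

lemma basic_nat_iff: "A \<in> R \<Longrightarrow> B \<in> basic_nat n A \<longleftrightarrow> B \<in> R \<and> r n B = r n A \<and> B \<preceq> A"
  unfolding basic_nat_def by (simp add: basic_iff)

lemma basic_mono: "B \<preceq> A \<Longrightarrow> A \<in> R \<Longrightarrow> B \<in> R \<Longrightarrow> basic a B \<subseteq> basic a A"
  unfolding basic_def using le_trans by blast

lemma compatible_mono:
  "compatible a B \<Longrightarrow> B \<preceq> A \<Longrightarrow> A \<in> R \<Longrightarrow> B \<in> R \<Longrightarrow> compatible a A"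
  unfolding compatible_def using basic_mono by blast

lemma compatible_r: "E \<in> R \<Longrightarrow> A \<in> R \<Longrightarrow> E \<preceq> A \<Longrightarrow> compatible (r n E) A"
  unfolding compatible_def basic_def by blast

lemma compatible_initial:
  assumes "compatible e D" "e \<in> AR" "E \<in> R" "r (len e) E = e" "n \<le> len e"
  shows "compatible (r n E) D"
proof -
  obtain W where W: "W \<in> R" "r (len e) W = e" "W \<preceq> D"
    using assms(1,2) basic_iff unfolding compatible_def by blast
  have "r n W = r n E" using r_eq_mono[of "len e" W E n] W assms by simp
  then show ?thesis using W unfolding compatible_def basic_def by blast
qed

lemma basic_nat_refl: "A \<in> R \<Longrightarrow> A \<in> basic_nat n A"
  by (simp add: basic_nat_iff le_refl)

lemma basic_nat_trans:
  assumes "A \<in> R" "B \<in> basic_nat m A" "C \<in> basic_nat n B" "k \<le> m" "k \<le> n"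
  shows "C \<in> basic_nat k A"
proof -
  have B: "B \<in> R" "r m B = r m A" "B \<preceq> A" using assms by (auto simp: basic_nat_iff)
  then have C: "C \<in> R" "r n C = r n B" "C \<preceq> B" using assms by (auto simp: basic_nat_iff)
  show ?thesis
    using B C assms r_eq_mono[of m B A k] r_eq_mono[of n C B k] le_trans[of C B A]
    by (simp add: basic_nat_iff)
qed

lemma basic_nat_antimono:
  "A \<in> R \<Longrightarrow> B \<in> basic_nat n A \<Longrightarrow> k \<le> n \<Longrightarrow> B \<in> basic_nat k A"
  using basic_nat_trans[OF _ basic_nat_refl] by blast

text \<open>A \<open>LEAST\<close> carries information only if some number qualifies: compatibility
  supplies a member of \<open>R\<close> below \<open>A\<close> through \<open>a\<close>, and (A.4)
  then bounds \<open>a\<close> by an approximation of \<open>A\<close>.\<close>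

lemma depth_lefin:
  assumes "a \<in> AR" "A \<in> R" "compatible a A"
  shows "a \<preceq>\<^sub>f r (depth A a) A"
proof -
  obtain B where "B \<in> R" "r (len a) B = a" "B \<preceq> A"
    using assms basic_iff unfolding compatible_def by blast
  then obtain m where "a \<preceq>\<^sub>f r m A" using A4_le assms by metis
  then show ?thesis unfolding depth_def by (rule LeastI)
qed

lemma depth_le: "a \<preceq>\<^sub>f r n A \<Longrightarrow> depth A a \<le> n"
  unfolding depth_def by (rule Least_le)

text \<open>Which of the approximations of length at most \<open>n\<close> lie above
  \<open>a\<close> is determined by \<open>r n A\<close>, so the least such length is the same in
  \<open>A\<close> and \<open>B\<close>. This transfers depths between the stages of a
  fusion.\<close>

lemma depth_cong:
  assumes "a \<in> AR" "A \<in> R" "B \<in> R" "compatible a A" "r n A = r n B" "depth A a \<le> n"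
  shows "depth B a = depth A a"
proof -
  have eq: "r i B = r i A" if "i \<le> n" for i
    using r_eq_mono assms that by metis
  have l: "a \<preceq>\<^sub>f r (depth A a) B" using depth_lefin assms eq by metis
  then have "depth B a \<le> depth A a" by (rule depth_le)
  moreover have "a \<preceq>\<^sub>f r (depth B a) B" using l unfolding depth_def by (rule LeastI)
  then have "depth A a \<le> depth B a" using calculation assms eq depth_le by (metis order.trans)
  ultimately show ?thesis by simp
qed

lemma compatible_basic_nat:
  assumes "a \<in> AR" "A \<in> R" "compatible a A" "B \<in> basic_nat n A" "depth A a \<le> n"
  shows "compatible a B"
proof -
  have "B \<in> basic_nat (depth A a) A"
    using basic_nat_antimono assms by blast
  then show ?thesis using A5_i assms unfolding compatible_def by blast
qed

lemma finite_depth_le: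
  assumes "A \<in> R"
  shows "finite {c \<in> AR. compatible c A \<and> depth A c \<le> n}"
proof -
  have "{c \<in> AR. compatible c A \<and> depth A c \<le> n} \<subseteq> (\<Union>i\<le>n. {b \<in> AR. b \<preceq>\<^sub>f r i A})"
    using depth_lefin assms by auto
  then show ?thesis
    by (rule finite_subset) (use A4_finite assms in auto)
qed

text \<open>By (A.3) the approximations of \<open>D\<close> are pairwise distinct, while only
  finitely many compatible ones have bounded depth in \<open>A\<close>.\<close>

lemma depth_unbounded:
  assumes "D \<in> R" "A \<in> R" "D \<preceq> A"
  shows "\<exists>n. N \<le> depth A (r n D)"
proof (rule ccontr)
  assume "\<not> ?thesis"
  then have "range (\<lambda>n. r n D) \<subseteq> {c \<in> AR. compatible c A \<and> depth A c \<le> N}"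
    using assms compatible_r by (auto simp: not_le intro: less_imp_le)
  moreover have "inj (\<lambda>n. r n D)" by (rule injI) (use A3 assms in blast)
  ultimately have "finite (UNIV :: nat set)"
    using finite_subset[OF _ finite_depth_le[OF assms(2)]] finite_imageD by blast
  then show False by simp
qed

text \<open>If \<open>s\<close> were outside the closed image of \<open>R\<close>, a basic open box
  around \<open>s\<close> would miss that image. The box restricts finitely many coordinates only,
  so a member of \<open>R\<close> agreeing with \<open>s\<close> that far would lie in it.\<close>

lemma approx_seq_closed:
  assumes "\<And>n. \<exists>A\<in>R. \<forall>i\<le>n. r i A = s i"
  shows "\<exists>A\<in>R. \<forall>n. r n A = s n"
proof (rule ccontr)
  assume neg: "\<not> ?thesis"
  have top: "topspace approx_topology = {s. \<forall>n. s n \<in> AR}"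
    unfolding approx_topology_def by (auto simp: PiE_def Pi_def)
  have "s \<in> topspace approx_topology"
    unfolding top
  proof (clarify)
    fix n
    show "s n \<in> AR" using assms[of n] r_in_AR by (metis order_refl)
  qed
  moreover have "s \<notin> approx_seq ` R" using neg unfolding approx_seq_def by auto
  moreover have "openin approx_topology (topspace approx_topology - approx_seq ` R)"
    using closed unfolding metrically_closed_def by (rule openin_diff[OF openin_topspace])
  ultimately obtain U where U: "finite {i. U i \<noteq> AR}" "s \<in> Pi\<^sub>E UNIV U"
    "Pi\<^sub>E UNIV U \<subseteq> topspace approx_topology - approx_seq ` R"
    unfolding approx_topology_def openin_product_topology_alt by auto blast
  obtain n where n: "\<And>i. U i \<noteq> AR \<Longrightarrow> i \<le> n"
    using U(1) unfolding finite_nat_set_iff_bounded_le by blast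
  obtain A where A: "A \<in> R" "\<forall>i\<le>n. r i A = s i" using assms by blast
  have "r i A \<in> U i" for i
  proof (cases "U i = AR")
    case False
    then have "r i A = s i" using n A by blast
    then show ?thesis using U(2) by (auto simp: PiE_def Pi_def)
  qed (use A in auto)
  then have "approx_seq A \<in> Pi\<^sub>E UNIV U" unfolding approx_seq_def by auto
  then show False using U(3) A(1) by blast
qed

text \<open>A basic open box around \<open>E\<close> restricts finitely many coordinates. Past the
  last of them agreement at a single length suffices, since by (A.3) it forces agreement at all
  shorter lengths.\<close>

lemma metric_open_nbhd:
  assumes "metric_open X" "E \<in> X"
  obtains n where "\<And>m E'. n \<le> m \<Longrightarrow> E' \<in> R \<Longrightarrow> r m E' = r m E \<Longrightarrow> E' \<in> X"
proof -
  obtain V where V: "openin approx_topology V" "X = approx_seq -` V \<inter> R"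
    using assms(1) unfolding metric_open_def metric_topology_def openin_pullback_topology by blast
  then have ER: "E \<in> R" "approx_seq E \<in> V" using assms(2) by auto
  then obtain U where U: "finite {i. U i \<noteq> AR}" "approx_seq E \<in> Pi\<^sub>E UNIV U" "Pi\<^sub>E UNIV U \<subseteq> V"
    using V(1) unfolding approx_topology_def openin_product_topology_alt by auto
  obtain n where n: "\<And>i. U i \<noteq> AR \<Longrightarrow> i \<le> n"
    using U(1) unfolding finite_nat_set_iff_bounded_le by blast
  show thesis
  proof (rule that)
    fix m E' assume a: "n \<le> m" "E' \<in> R" "r m E' = r m E"
    have "r i E' \<in> U i" for i
    proof (cases "U i = AR")
      case False
      then have "r i E' = r i E" using n a ER r_eq_mono by (meson order.trans)
      then show ?thesis using U(2) unfolding approx_seq_def by (auto simp: PiE_def Pi_def)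
    qed (use a in auto)
    then have "approx_seq E' \<in> Pi\<^sub>E UNIV U" unfolding approx_seq_def by auto
    then show "E' \<in> X" using U(3) V(2) a by blast
  qed
qed

text \<open>Length \<open>i\<close> is frozen once \<open>i <= M n\<close>, so the
  \<open>C n\<close> have a coordinatewise limit, which closedness realises in
  \<open>R\<close>.\<close>

lemma fusion_limit:
  assumes C: "\<And>n. C n \<in> R" and step: "\<And>n. C (Suc n) \<in> basic_nat (M n) (C n)"
    and M: "\<And>n. M n \<le> M (Suc n)" and unb: "\<And>k. \<exists>n. k \<le> M n"
  shows "\<exists>B\<in>R. \<forall>n. B \<in> basic_nat (M n) (C n)"
proof -
  have mono: "M n \<le> M m" if "n \<le> m" for n m
    using M that by (rule lift_Suc_mono_le)
  have tr: "C m \<in> basic_nat (M n) (C n)" if "n \<le> m" for n m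
    using that
  proof (induction rule: dec_induct)
    case base show ?case by (rule basic_nat_refl[OF C])
  next
    case (step k)
    show ?case using basic_nat_trans[OF C step.IH assms(2)[of k]] mono step.hyps by simp
  qed
  obtain f where f: "\<And>k. k \<le> M (f k)" using unb by metis
  have eq: "r i (C m) = r i (C n)" if "n \<le> m" "i \<le> M n" for i m n
    using tr[OF that(1)] r_eq_mono[of "M n" "C m" "C n" i] that(2) C by (simp add: basic_nat_iff)
  define s where "s i = r i (C (f i))" for i
  have s: "s i = r i (C n)" if "i \<le> M n" for i n
    using eq[of n "f i" i] eq[of "f i" n i] f[of i] that unfolding s_def by (metis nat_le_linear)
  have "\<exists>A\<in>R. \<forall>i\<le>n. r i A = s i" for n
    using s[of _ "f n"] f[of n] C[of "f n"] by (intro bexI[of _ "C (f n)"]) auto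
  then obtain B where B: "B \<in> R" "\<And>n. r n B = s n" using approx_seq_closed by metis
  \<comment> \<open>(A.4) is tested one approximation at a time: the \<open>i\<close>-th
    approximation of \<open>B\<close> already occurs in some stage from \<open>n\<close> on, and
    that stage lies below \<open>C n\<close>.\<close>
  have "B \<preceq> C n" for n
    unfolding A4_le[OF B(1) C]
  proof
    fix i
    have "C (max n (f i)) \<preceq> C n" using tr[of n "max n (f i)"] C by (simp add: basic_nat_iff)
    moreover have "r i B = r i (C (max n (f i)))"
      using B s[of i "max n (f i)"] f[of i] mono[of "f i" "max n (f i)"] by simp
    ultimately show "\<exists>m. r i B \<preceq>\<^sub>f r m (C n)" using A4_le C by metis
  qed
  then show ?thesis using B s C by (auto simp: basic_nat_iff intro!: bexI[of _ B])
qed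

end

section \<open>Passing through finitely many approximations\<close>

locale selective_coideal_in_space = topological_Ramsey_space R le r lefin emp
  for R :: "'r set"
    and le :: "'r \<Rightarrow> 'r \<Rightarrow> bool"  (infix \<open>\<preceq>\<close> 50)
    and r :: "nat \<Rightarrow> 'r \<Rightarrow> 'a"
    and lefin :: "'a \<Rightarrow> 'a \<Rightarrow> bool"  (infix \<open>\<preceq>\<^sub>f\<close> 50)
    and emp :: 'a +
  fixes H :: "'r set"
  assumes selective_coideal: "selective_coideal H"
begin

lemma coideal_subset: "H \<subseteq> R"
  and coideal_upward: "\<forall>A\<in>R. \<forall>B\<in>R. A \<preceq> B \<longrightarrow> A \<in> H \<longrightarrow> B \<in> H"
  and coideal_extension: "\<forall>A\<in>H. \<forall>a\<in>AR_below A.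
        (\<forall>B \<in> basic_nat (depth A a) A \<inter> H. basic a B \<inter> H \<noteq> {}) \<and>
        (\<forall>B \<in> basic a A \<inter> H. \<exists>A' \<in> basic_nat (depth A a) A \<inter> H. basic a A' \<subseteq> basic a B)"
  and coideal_pigeonhole: "\<forall>a\<in>AR. \<forall>Q \<subseteq> AR_level (len a + 1). \<forall>A\<in>H. basic a A \<noteq> {} \<longrightarrow>
        (\<exists>B \<in> basic_nat (depth A a) A \<inter> H.
           r (len a + 1) ` basic a B \<subseteq> Q \<or>
           r (len a + 1) ` basic a B \<subseteq> AR_level (len a + 1) - Q)"
  using selective_coideal unfolding selective_coideal_def coideal_def by - (elim conjE, assumption)+

lemma H_subset: "A \<in> H \<Longrightarrow> A \<in> R"
  using coideal_subset by blast

lemma H_upward: "A \<in> H \<Longrightarrow> A \<preceq> B \<Longrightarrow> B \<in> R \<Longrightarrow> B \<in> H"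
  using coideal_upward H_subset by blast

lemma H_meets_basic:
  assumes "A \<in> H" "a \<in> AR" "compatible a A"
  shows "\<exists>B\<in>H. B \<in> basic a A"
proof -
  have "A \<in> basic_nat (depth A a) A \<inter> H" using assms basic_nat_refl H_subset by blast
  moreover have "a \<in> AR_below A" using assms unfolding AR_below_def by blast
  ultimately show ?thesis
    using assms(1) coideal_extension by blast
qed

lemma H_amalgamation:
  assumes "A \<in> H" "a \<in> AR" "B \<in> basic a A" "B \<in> H"
  shows "\<exists>A'\<in>H. A' \<in> basic_nat (depth A a) A \<and> basic a A' \<subseteq> basic a B"
proof -
  have "a \<in> AR_below A" using assms unfolding AR_below_def compatible_def by blast
  then show ?thesis using assms coideal_extension by blast
qed

text \<open>Condition (3) of a coideal with an arbitrary predicate \<open>S\<close> as colouring;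
  (A.5)(i) keeps \<open>a\<close> compatible with \<open>B\<close>.\<close>

lemma H_pigeonhole:
  assumes "A \<in> H" "a \<in> AR" "compatible a A"
  obtains B where "B \<in> H" "B \<in> basic_nat (depth A a) A" "compatible a B" "B \<preceq> A"
    "(\<forall>E\<in>basic a B. S (r (Suc (len a)) E)) \<or> (\<forall>E\<in>basic a B. \<not> S (r (Suc (len a)) E))"
proof -
  define Q where "Q = {b \<in> AR_level (len a + 1). S b}"
  have "Q \<subseteq> AR_level (len a + 1)" unfolding Q_def by blast
  then obtain B where B: "B \<in> basic_nat (depth A a) A" "B \<in> H"
    "r (len a + 1) ` basic a B \<subseteq> Q \<or> r (len a + 1) ` basic a B \<subseteq> AR_level (len a + 1) - Q"
    using coideal_pigeonhole assms unfolding compatible_def by blast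
  have "(\<forall>E\<in>basic a B. S (r (Suc (len a)) E)) \<or> (\<forall>E\<in>basic a B. \<not> S (r (Suc (len a)) E))"
    using B(3) unfolding Q_def by (simp add: image_subset_iff) blast
  moreover have "compatible a B"
    using compatible_basic_nat[OF assms(2) H_subset[OF assms(1)] assms(3) B(1)] by simp
  moreover have "B \<preceq> A" using B(1) H_subset[OF assms(1)] by (simp add: basic_nat_iff)
  ultimately show thesis using that B by blast
qed

text \<open>Induction on the number of steps from \<open>a\<close> to \<open>e\<close>. The
  pigeonhole principle decides whether the next approximation is the segment \<open>e1\<close> of
  \<open>e\<close>. If it is always avoided, so is \<open>e\<close>; if it is always met, the
  induction hypothesis applies at \<open>e1\<close>.\<close>

lemma decide_passage:
  assumes "e \<in> AR" "a \<in> AR" "len a \<le> len e" "D \<in> H" "compatible a D"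
  shows "\<exists>D'\<in>H. D' \<preceq> D \<and> compatible a D' \<and>
    ((\<forall>E\<in>basic a D'. r (len e) E = e) \<or> (\<forall>E\<in>basic a D'. r (len e) E \<noteq> e))"
  using assms
proof (induction "len e - len a" arbitrary: a D)
  case 0
  then have "len e = len a" by simp
  then have "\<forall>E\<in>basic a D. r (len e) E = a" using 0 by (simp add: basic_iff)
  then show ?case using 0 H_subset le_refl by (intro bexI[of _ D]) auto
next
  case (Suc k)
  have DR: "D \<in> R" using Suc H_subset by blast
  show ?case
  proof (cases "\<exists>E\<in>basic a D. r (len e) E = e")
    case False
    then show ?thesis using Suc.prems DR le_refl by (intro bexI[of _ D]) auto
  next
    case True
    then obtain E0 where E0: "E0 \<in> R" "r (len a) E0 = a" "E0 \<preceq> D" "r (len e) E0 = e"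
      using basic_iff Suc.prems by blast
    have less: "Suc (len a) \<le> len e" using Suc.hyps(2) by simp
    define e1 where "e1 = r (Suc (len a)) E0"
    have e1: "e1 \<in> AR" "len e1 = Suc (len a)" using E0 unfolding e1_def by auto
    obtain B where B: "B \<in> H" "compatible a B" "B \<preceq> D"
      "(\<forall>E\<in>basic a B. r (Suc (len a)) E = e1) \<or> (\<forall>E\<in>basic a B. r (Suc (len a)) E \<noteq> e1)"
      using H_pigeonhole[OF Suc.prems(4,2,5), of "\<lambda>x. x = e1"] by metis
    have BR: "B \<in> R" using B H_subset by blast
    show ?thesis
    proof (cases "\<forall>E\<in>basic a B. r (Suc (len a)) E = e1")
      case True
      obtain E where E: "E \<in> basic a B" using B unfolding compatible_def by blast
      then have "compatible e1 B"
        using True compatible_r[of E B "Suc (len a)"] BR Suc.prems by (auto simp: basic_iff)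
      moreover have "k = len e - len e1" using Suc.hyps(2) e1 by simp
      ultimately obtain D' where D': "D' \<in> H" "D' \<preceq> B" "compatible e1 D'"
        "(\<forall>E\<in>basic e1 D'. r (len e) E = e) \<or> (\<forall>E\<in>basic e1 D'. r (len e) E \<noteq> e)"
        using Suc.hyps(1)[of e1 B] e1 Suc.prems(1) less B(1) by metis
      have D'R: "D' \<in> R" using D' H_subset by blast
      have "compatible a D'"
        using compatible_initial[OF D'(3) e1(1) E0(1), of "len a"] e1 E0 unfolding e1_def by simp
      moreover have "basic a D' \<subseteq> basic e1 D'"
      proof
        fix F assume F: "F \<in> basic a D'"
        then have "F \<in> basic a B" using basic_mono D' BR D'R by blast
        then show "F \<in> basic e1 D'" using True F e1 Suc.prems by (simp add: basic_iff)
      qed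
      moreover have "D' \<preceq> D" using le_trans[OF D'(2) B(3)] D'R BR DR by blast
      ultimately show ?thesis using D' by blast
    next
      case False
      have "r (len e) E \<noteq> e" if E: "E \<in> basic a B" for E
      proof
        assume "r (len e) E = e"
        then have "r (Suc (len a)) E = e1"
          using r_eq_mono[of "len e" E E0 "Suc (len a)"] E0 E less Suc.prems
          unfolding e1_def by (simp add: basic_iff)
        then show False using False B(4) E by blast
      qed
      then show ?thesis using B by blast
    qed
  qed
qed

lemma decide_passages:
  assumes "finite T" "T \<subseteq> {e \<in> AR. len a \<le> len e}" "a \<in> AR" "D \<in> H" "compatible a D"
  shows "\<exists>D'\<in>H. D' \<preceq> D \<and> compatible a D' \<and>
    (\<forall>e\<in>T. (\<forall>E\<in>basic a D'. r (len e) E = e) \<or> (\<forall>E\<in>basic a D'. r (len e) E \<noteq> e))"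
  using assms(1,2)
proof (induction)
  case empty
  then show ?case using assms H_subset le_refl by auto
next
  case (insert e T)
  then obtain D1 where D1: "D1 \<in> H" "D1 \<preceq> D" "compatible a D1"
    "\<forall>e\<in>T. (\<forall>E\<in>basic a D1. r (len e) E = e) \<or> (\<forall>E\<in>basic a D1. r (len e) E \<noteq> e)"
    by auto
  obtain D2 where D2: "D2 \<in> H" "D2 \<preceq> D1" "compatible a D2"
    "(\<forall>E\<in>basic a D2. r (len e) E = e) \<or> (\<forall>E\<in>basic a D2. r (len e) E \<noteq> e)"
    using decide_passage[of e a D1] insert.prems D1 assms(3) by auto
  have "basic a D2 \<subseteq> basic a D1" using basic_mono D1 D2 H_subset by blast
  moreover have "D2 \<preceq> D" using le_trans[OF D2(2) D1(2)] D1 D2 assms H_subset by blast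
  ultimately show ?case using D1 D2 by (intro bexI[of _ D2]) blast+
qed

text \<open>Take \<open>c\<close> longest among the members of \<open>insert a T\<close> through
  which passage can be forced below \<open>D\<close>. Once passage through the longer members of
  \<open>T\<close> is decided, the decision must be avoidance, by maximality of
  \<open>c\<close>.\<close>

lemma escape_finite:
  assumes "finite T" "T \<subseteq> AR" "a \<in> AR" "D \<in> H" "compatible a D"
  obtains D' c where "D' \<in> H" "D' \<preceq> D" "compatible a D'" "c \<in> insert a T" "len a \<le> len c"
    "\<And>E. E \<in> basic a D' \<Longrightarrow> r (len c) E = c"
    "\<And>E n. E \<in> basic a D' \<Longrightarrow> len c < n \<Longrightarrow> r n E \<notin> T"
proof -
  define G where "G = {c \<in> insert a T. len a \<le> len c \<and>
    (\<exists>D'\<in>H. D' \<preceq> D \<and> compatible a D' \<and> (\<forall>E\<in>basic a D'. r (len c) E = c))}"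
  have "finite G" using assms(1) unfolding G_def by simp
  moreover have "a \<in> G"
    using assms le_refl H_subset unfolding G_def by (auto simp: basic_iff intro!: bexI[of _ D])
  ultimately have "Max (len ` G) \<in> len ` G" by (intro Max_in) auto
  then obtain c where c: "c \<in> G" "\<And>e. e \<in> G \<Longrightarrow> len e \<le> len c"
    using Max_ge[of "len ` G"] \<open>finite G\<close> by fastforce
  then obtain D1 where D1: "D1 \<in> H" "D1 \<preceq> D" "compatible a D1"
    "\<forall>E\<in>basic a D1. r (len c) E = c" unfolding G_def by blast
  have lac: "len a \<le> len c" using c(1) unfolding G_def by blast
  have "finite {e \<in> T. len c < len e}" "{e \<in> T. len c < len e} \<subseteq> {e \<in> AR. len a \<le> len e}"
    using assms lac by auto
  then obtain D2 where D2: "D2 \<in> H" "D2 \<preceq> D1" "compatible a D2"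
    "\<And>e. e \<in> T \<Longrightarrow> len c < len e \<Longrightarrow>
      (\<forall>E\<in>basic a D2. r (len e) E = e) \<or> (\<forall>E\<in>basic a D2. r (len e) E \<noteq> e)"
    using decide_passages[of "{e \<in> T. len c < len e}" a D1] assms(3) D1(1,3) by blast
  have sub: "basic a D2 \<subseteq> basic a D1" using basic_mono D1 D2 H_subset by blast
  have D2D: "D2 \<preceq> D" using le_trans[OF D2(2) D1(2)] D1 D2 assms H_subset by blast
  show thesis
  proof (rule that[OF D2(1) D2D D2(3) _ lac])
    show "c \<in> insert a T" using c(1) unfolding G_def by blast
    show "r (len c) E = c" if "E \<in> basic a D2" for E using that sub D1 by blast
    fix E n assume E: "E \<in> basic a D2" and n: "len c < n"
    show "r n E \<notin> T"
    proof
      \<comment> \<open>Passage through this element has been decided, and \<open>E\<close> itself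
        rules out avoidance. So passage is forced and the element lies in \<open>G\<close>, although
        it is longer than \<open>c\<close>.\<close>
      assume T: "r n E \<in> T"
      have ER: "E \<in> R" using E unfolding basic_def by blast
      then have "\<forall>E'\<in>basic a D2. r n E' = r n E"
        using D2(4)[OF T] n E by auto
      then have "r n E \<in> G"
        using T ER n lac D2 D2D unfolding G_def by auto
      then show False using c(2) n ER by fastforce
    qed
  qed
qed

section \<open>Fusion inside a selective coideal\<close>

text \<open>\<open>Q j C\<close> reads: level \<open>j\<close> of \<open>C\<close> is treated. The
  treated levels form a half-open interval, so that the intervals of successive advances fit
  together without gaps.\<close>

definition advances :: "(nat \<Rightarrow> 'r \<Rightarrow> bool) \<Rightarrow> 'r \<Rightarrow> 'a \<Rightarrow> 'a \<Rightarrow> 'r \<Rightarrow> bool" where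
  "advances Q C b b' C' \<longleftrightarrow> C' \<in> H \<and> C' \<in> basic_nat (depth C b) C \<and> compatible b' C' \<and>
     depth C b < depth C' b' \<and> (\<forall>j. depth C b \<le> j \<and> j < depth C' b' \<longrightarrow> Q j C')"

text \<open>Escaping a finite set yields \<open>c\<close> after which the depth in \<open>C\<close>
  first exceeds that of \<open>b\<close>, along every extension. The pigeonhole principle at
  \<open>c\<close> then makes the existence of an advance uniform over the next approximations, and
  exhibiting one advance excludes the negative alternative.\<close>

lemma fusion_step:
  assumes "A \<in> H"
    and step: "\<And>C j. C \<in> H \<Longrightarrow> C \<preceq> A \<Longrightarrow> \<exists>C'\<in>H. C' \<in> basic_nat j C \<and> Q j C'"
    and hered: "\<And>C C' j. Q j C \<Longrightarrow> C \<in> H \<Longrightarrow> C \<preceq> A \<Longrightarrow> C' \<in> H \<Longrightarrow> C' \<in> basic_nat j C \<Longrightarrow> Q j C'"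
    and C: "C \<in> H" "C \<preceq> A" and b: "b \<in> AR" "compatible b C"
  shows "\<exists>D l. D \<in> H \<and> D \<preceq> C \<and> compatible b D \<and> len b < l \<and>
    (\<forall>E\<in>basic b D. (\<forall>n. len b \<le> n \<longrightarrow> n < l \<longrightarrow> depth C (r n E) \<le> depth C b) \<and>
       (\<exists>C'. advances Q C b (r l E) C'))"
proof -
  have CR: "C \<in> R" and AinR: "A \<in> R" using C assms(1) H_subset by auto
  define M where "M = depth C b"
  \<comment> \<open>Depth is bounded at every intermediate length, so \<open>c\<close> in
    \<open>T\<close> bounds all its segments from \<open>b\<close> on; conversely one more
    approximation of small depth would again lie in \<open>T\<close>, hence the depth jumps right
    after \<open>c\<close>.\<close>
  define T where "T = {r n E |n E. E \<in> basic b C \<and> len b \<le> n \<and>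
    (\<forall>i. len b \<le> i \<longrightarrow> i \<le> n \<longrightarrow> depth C (r i E) \<le> M)}"
  have bC: "E \<in> R \<and> r (len b) E = b \<and> E \<preceq> C" if "E \<in> basic b C" for E
    using that b basic_iff by blast
  have "T \<subseteq> {c \<in> AR. compatible c C \<and> depth C c \<le> M}"
    unfolding T_def using bC compatible_r CR by auto
  then have T: "finite T" "T \<subseteq> AR" using finite_depth_le[OF CR] finite_subset by blast+
  obtain D1 c where D1: "D1 \<in> H" "D1 \<preceq> C" "compatible b D1" "c \<in> insert b T" "len b \<le> len c"
    and through: "\<And>E. E \<in> basic b D1 \<Longrightarrow> r (len c) E = c"
    and escape: "\<And>E n. E \<in> basic b D1 \<Longrightarrow> len c < n \<Longrightarrow> r n E \<notin> T"
    using escape_finite[OF T b(1) C(1) b(2)] by blast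
  have D1R: "D1 \<in> R" using D1 H_subset by blast
  have D1C: "basic b D1 \<subseteq> basic b C" using basic_mono D1 D1R CR by blast
  have low: "depth C (r i E) \<le> M" if E: "E \<in> basic b D1" and i: "len b \<le> i" "i \<le> len c" for E i
  proof (cases "c = b")
    case True
    then have "r i E = b" using i bC E D1C by (metis le_antisym subsetD)
    then show ?thesis unfolding M_def by simp
  next
    case False
    then obtain n E1 where E1: "c = r n E1" "E1 \<in> basic b C"
      "\<forall>i. len b \<le> i \<longrightarrow> i \<le> n \<longrightarrow> depth C (r i E1) \<le> M"
      using D1(4) unfolding T_def by blast
    then have n: "n = len c" using bC len_r by metis
    have "E \<in> R" "E1 \<in> R" using bC E E1(2) D1C by blast+
    moreover have "r n E = r n E1" using through[OF E] E1(1) n by metis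
    ultimately have "r i E = r i E1" using r_eq_mono i n by blast
    then show ?thesis using E1(3) i n by simp
  qed
  have high: "M < depth C (r (Suc (len c)) E)" if E: "E \<in> basic b D1" for E
  proof (rule ccontr)
    assume "\<not> ?thesis"
    then have "\<forall>i. len b \<le> i \<longrightarrow> i \<le> Suc (len c) \<longrightarrow> depth C (r i E) \<le> M"
      using low[OF E] by (auto simp: le_Suc_eq)
    then have "r (Suc (len c)) E \<in> T" unfolding T_def using E D1C D1(5) le_SucI by blast
    then show False using escape[OF E] by blast
  qed
  have c: "c \<in> AR" using D1(4) T b by blast
  have cD: "compatible b D" if "D \<preceq> D1" "compatible c D" "D \<in> R" for D
  proof -
    obtain E where E: "E \<in> basic b D1" using D1(3) unfolding compatible_def by blast
    show ?thesis
      using compatible_initial[OF that(2) c _ through[OF E] D1(5)] bC[of E] E D1C by auto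
  qed
  obtain E0 where E0: "E0 \<in> basic b D1" using D1(3) unfolding compatible_def by blast
  then have "E0 \<in> basic c D1" using through[OF E0] b c by (simp add: basic_iff)
  then have "compatible c D1" unfolding compatible_def by blast
  then obtain D where D: "D \<in> H" "compatible c D" "D \<preceq> D1"
    and dich: "(\<forall>E\<in>basic c D. \<exists>C'. advances Q C b (r (Suc (len c)) E) C') \<or>
      (\<forall>E\<in>basic c D. \<not> (\<exists>C'. advances Q C b (r (Suc (len c)) E) C'))"
    using H_pigeonhole[OF D1(1) c, of "\<lambda>x. \<exists>C'. advances Q C b x C'"] by metis
  have DR: "D \<in> R" using D H_subset by blast
  have bD: "compatible b D" using cD D DR by blast
  have sub: "basic b D \<subseteq> basic b D1" using basic_mono D D1R DR by blast
  have sub2: "basic b D \<subseteq> basic c D"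
    using through sub b c basic_iff by blast
  have DC: "D \<preceq> C" using le_trans[OF D(3) D1(2)] DR D1R CR by blast
  \<comment> \<open>A fusion carried out in \<open>R\<close> alone leaves \<open>H\<close>, but its limit still has an element \<open>E\<close> below \<open>D\<close>, and
    the successor of \<open>c\<close> along \<open>E\<close> already has its depth at a finite stage, which lies in \<open>H\<close>.\<close>
  have "\<exists>E\<in>basic b D. \<exists>C'. advances Q C b (r (Suc (len c)) E) C'"
  proof -
    obtain D0 where D0: "D0 \<in> H" "D0 \<in> basic b D" using H_meets_basic[OF D(1) b(1) bD] by blast
    then have "D0 \<in> basic b C" using sub D1C by blast
    \<comment> \<open>\<open>D\<close> need not agree with \<open>C\<close> up to length
      \<open>M\<close>. Amalgamation gives a starting point that does, while its members through
      \<open>b\<close> still lie below \<open>D\<close>.\<close>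
    then obtain C0 where C0: "C0 \<in> H" "C0 \<in> basic_nat M C" "basic b C0 \<subseteq> basic b D0"
      using H_amalgamation[OF C(1) b(1) _ D0(1)] unfolding M_def by blast
    define inv where "inv n X \<longleftrightarrow> X \<in> H \<and> X \<in> basic_nat M C" for n :: nat and X
    have invA: "X \<preceq> A \<and> X \<in> R" if "inv n X" for n X
      using that le_trans[of X C A] CR AinR C unfolding inv_def by (auto simp: basic_nat_iff)
    have "\<exists>F. \<forall>n. (inv n (F n) \<and> (n = 0 \<longrightarrow> F n = C0)) \<and>
      (F (Suc n) \<in> basic_nat (M + n) (F n) \<and> Q (M + n) (F (Suc n)))"
    proof (rule dependent_nat_choice)
      show "\<exists>X. inv 0 X \<and> (0 = 0 \<longrightarrow> X = C0)" using C0 unfolding inv_def by blast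
      fix X and n :: nat assume "inv n X \<and> (n = 0 \<longrightarrow> X = C0)"
      then have X: "inv n X" by blast
      then obtain C' where C': "C' \<in> H" "C' \<in> basic_nat (M + n) X" "Q (M + n) C'"
        using step[of X "M + n"] invA[OF X] unfolding inv_def by blast
      moreover have "C' \<in> basic_nat M C"
        using basic_nat_trans[OF CR _ C'(2), of M M] X unfolding inv_def by simp
      ultimately show "\<exists>Y. (inv (Suc n) Y \<and> (Suc n = 0 \<longrightarrow> Y = C0)) \<and> (Y \<in> basic_nat (M + n) X \<and> Q (M + n) Y)"
        unfolding inv_def by blast
    qed
    then obtain F where F: "F 0 = C0" "\<And>n. inv n (F n)" "\<And>n. F (Suc n) \<in> basic_nat (M + n) (F n)"
      "\<And>n. Q (M + n) (F (Suc n))" by blast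
    have FR: "F n \<in> R" "F n \<preceq> A" "F n \<in> H" for n using F(2) invA unfolding inv_def by blast+
    have "\<exists>n. k \<le> M + n" for k by (rule exI[of _ k]) simp
    then obtain L where L: "L \<in> R" "\<And>n. L \<in> basic_nat (M + n) (F n)"
      using fusion_limit[of F "\<lambda>n. M + n", OF FR(1) F(3)] by auto
    have LC: "L \<in> basic_nat M C"
      using basic_nat_trans[OF CR C0(2), of L M M] L(2)[of 0] F(1) by simp
    then have "compatible b L" using compatible_basic_nat[OF b(1) CR b(2)] unfolding M_def by blast
    then obtain E where E: "E \<in> basic b L" unfolding compatible_def by blast
    have "L \<preceq> C0" using L(2)[of 0] F(1) FR(1)[of 0] by (simp add: basic_nat_iff)
    then have "E \<in> basic b D0" using E C0 basic_mono[of L C0 b] L(1) H_subset by blast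
    then have ED: "E \<in> basic b D"
      using D0 basic_mono[of D0 D b] DR H_subset b by (auto simp: basic_iff)
    define b' where "b' = r (Suc (len c)) E"
    have ER: "E \<in> R" "E \<preceq> L" using E b basic_iff by auto
    have b': "b' \<in> AR" "compatible b' L" using ER L(1) compatible_r unfolding b'_def by auto
    \<comment> \<open>\<open>L\<close> and \<open>C\<close> agree up to \<open>M\<close>, so a depth
      of at most \<open>M\<close> in \<open>L\<close> would also be the depth in \<open>C\<close>,
      against \<open>high\<close>.\<close>
    have Mlt: "M < depth L b'"
    proof (rule ccontr)
      assume "\<not> ?thesis"
      moreover have "r M L = r M C" using LC CR by (simp add: basic_nat_iff)
      ultimately have "depth C b' = depth L b'" using depth_cong[OF b'(1) L(1) CR b'(2)] by simp
      then show False using high[of E] ED sub \<open>\<not> M < depth L b'\<close> unfolding b'_def by auto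
    qed
    \<comment> \<open>\<open>F k\<close> agrees with \<open>L\<close> up to the depth of
      \<open>b'\<close> in \<open>L\<close>, so \<open>b'\<close> has the same depth in
      \<open>F k\<close>. The levels \<open>M + i\<close> with \<open>i < k\<close> were treated at
      stages \<open>Suc i <= k\<close>.\<close>
    define k where "k = depth L b' - M"
    have k: "depth L b' = M + k" using Mlt unfolding k_def by simp
    have Lk: "r (M + k) L = r (M + k) (F k)" "L \<preceq> F k"
      using L(2)[of k] FR(1) by (auto simp: basic_nat_iff)
    have dk: "depth (F k) b' = M + k"
      using depth_cong[OF b'(1) L(1) FR(1) b'(2) Lk(1)] k by simp
    have tr: "F m \<in> basic_nat (M + n) (F n)" if "n \<le> m" for n m
      using that
    proof (induction rule: dec_induct)
      case base show ?case by (rule basic_nat_refl[OF FR(1)])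
    next
      case (step i)
      show ?case using basic_nat_trans[OF FR(1) step.IH F(3)[of i]] step.hyps by simp
    qed
    have Qk: "Q j (F k)" if j: "M \<le> j" "j < M + k" for j
    proof -
      obtain i where i: "j = M + i" using j le_Suc_ex by blast
      then have "F k \<in> basic_nat (M + Suc i) (F (Suc i))" using j tr[of "Suc i" k] by simp
      then have "F k \<in> basic_nat (M + i) (F (Suc i))"
        using basic_nat_antimono[OF FR(1)] by simp
      then show ?thesis using hered[OF F(4)[of i]] FR i by blast
    qed
    have "advances Q C b b' (F k)"
      unfolding advances_def M_def[symmetric]
      using F(2)[of k] compatible_mono[OF b'(2) Lk(2)] FR(1) L(1) dk Qk Mlt k unfolding inv_def by auto
    then show ?thesis using ED unfolding b'_def by blast
  qed
  then have "\<forall>E\<in>basic b D. \<exists>C'. advances Q C b (r (Suc (len c)) E) C'"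
    using dich sub2 by blast
  moreover have "\<forall>E\<in>basic b D. \<forall>n. len b \<le> n \<longrightarrow> n < Suc (len c) \<longrightarrow> depth C (r n E) \<le> depth C b"
    using low sub unfolding M_def by (auto simp: less_Suc_eq_le)
  ultimately show ?thesis using D(1) DC bD D1(5) by (intro exI[of _ D] exI[of _ "Suc (len c)"]) auto
qed

text \<open>
  The pair \<open>(C, b)\<close> consists of the current element of the fusion and the last approximation of \<open>D\<close> at
  which it was changed; it is a function of \<open>r n D\<close>, so it can index a family on \<open>AR\<close>.
  \<open>L C b\<close> is the length at which the next change occurs, and \<open>K\<close> makes it.
\<close>

primrec fusion_state ::
  "('r \<Rightarrow> 'a \<Rightarrow> nat) \<Rightarrow> ('r \<Rightarrow> 'a \<Rightarrow> 'a \<Rightarrow> 'r) \<Rightarrow> 'r \<Rightarrow> nat \<Rightarrow> 'r \<Rightarrow> nat \<Rightarrow> ('r \<times> 'a) option"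
where
  "fusion_state L K A N D 0 = (if N \<le> depth A (r 0 D) then Some (A, r 0 D) else None)"
| "fusion_state L K A N D (Suc n) = (case fusion_state L K A N D n of
     None \<Rightarrow> if N \<le> depth A (r (Suc n) D) then Some (A, r (Suc n) D) else None
   | Some (C, b) \<Rightarrow> if Suc n = L C b then Some (K C b (r (Suc n) D), r (Suc n) D) else Some (C, b))"

text \<open>The recursion reads only approximations of length at most \<open>n\<close>, and
  \<open>r n D\<close> determines these.\<close>

lemma fusion_state_cong:
  assumes "D \<in> R" "D' \<in> R" "r n D = r n D'"
  shows "fusion_state L K A N D n = fusion_state L K A N D' n"
  using assms(3)
proof (induction n)
  case (Suc n)
  then have "r n D = r n D'" using r_eq_mono[of "Suc n" D D' n] assms by simp
  then show ?case by (simp only: fusion_state.simps Suc.prems Suc.IH)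
qed simp

text \<open>Selectivity is applied to the family sending \<open>b\<close> to the element that
  \<open>fusion_step\<close> prepares for the state reached at \<open>b\<close>. The resulting
  \<open>D\<close> steers the fusion, and its limit \<open>B\<close> is in \<open>H\<close> because
  it lies above \<open>D\<close>.\<close>

lemma fusion:
  assumes A: "A \<in> H"
    and step: "\<And>C j. C \<in> H \<Longrightarrow> C \<preceq> A \<Longrightarrow> \<exists>C'\<in>H. C' \<in> basic_nat j C \<and> Q j C'"
    and hered: "\<And>C C' j. Q j C \<Longrightarrow> C \<in> H \<Longrightarrow> C \<preceq> A \<Longrightarrow> C' \<in> H \<Longrightarrow> C' \<in> basic_nat j C \<Longrightarrow> Q j C'"
  obtains m B where "N \<le> m" "B \<in> H" "B \<in> basic_nat m A" "\<And>j. m \<le> j \<Longrightarrow> Q j B"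
proof -
  have AinR: "A \<in> R" using A H_subset by blast
  define valid where "valid C b \<longleftrightarrow> C \<in> H \<and> C \<preceq> A \<and> b \<in> AR \<and> compatible b C" for C b
  define spec where "spec C b D l \<longleftrightarrow> D \<in> H \<and> D \<preceq> C \<and> compatible b D \<and> len b < l \<and>
    (\<forall>E\<in>basic b D. (\<forall>n. len b \<le> n \<longrightarrow> n < l \<longrightarrow> depth C (r n E) \<le> depth C b) \<and>
       (\<exists>C'. advances Q C b (r l E) C'))" for C b D l
  have "\<exists>D l. spec C b D l" if "valid C b" for C b
    unfolding spec_def
  proof (rule fusion_step[OF A])
    show "C \<in> H" "C \<preceq> A" "b \<in> AR" "compatible b C" using that unfolding valid_def by blast+
  qed (fact step, fact hered)
  then obtain W L where WL: "\<And>C b. valid C b \<Longrightarrow> spec C b (W C b) (L C b)" by metis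
  define K where "K C b b' = (SOME C'. advances Q C b b' C')" for C b b'
  define st where "st = fusion_state L K A N"
  \<comment> \<open>Only approximations at which the state is newly set are indexed; there its
    second component is the approximation just read.\<close>
  define I where "I = {b \<in> AR. \<exists>D\<in>R. \<exists>C. r (len b) D = b \<and> st D (len b) = Some (C, b) \<and> valid C b}"
  \<comment> \<open>The \<open>SOME\<close> is unambiguous, since the state depends only on the
    approximation read.\<close>
  define F where "F b = W (SOME C. \<exists>D\<in>R. r (len b) D = b \<and> st D (len b) = Some (C, b)) b" for b
  have F_eq: "F b = W C b" if "D \<in> R" "r (len b) D = b" "st D (len b) = Some (C, b)" for D C b
  proof -
    have "(SOME C. \<exists>D\<in>R. r (len b) D = b \<and> st D (len b) = Some (C, b)) = C"
    proof (rule some_equality)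
      show "\<exists>D\<in>R. r (len b) D = b \<and> st D (len b) = Some (C, b)" using that by blast
      fix C' assume "\<exists>D\<in>R. r (len b) D = b \<and> st D (len b) = Some (C', b)"
      then obtain D' where D': "D' \<in> R" "r (len b) D' = b" "st D' (len b) = Some (C', b)" by blast
      then have "st D' (len b) = st D (len b)"
        using fusion_state_cong[of D' D "len b"] that unfolding st_def by simp
      then show "C' = C" using D' that by simp
    qed
    then show ?thesis unfolding F_def by simp
  qed
  have F_ok: "F b \<in> restr H A \<and> basic b (F b) \<noteq> {}" if b: "b \<in> I" for b
  proof -
    obtain D C where D: "D \<in> R" "r (len b) D = b" "st D (len b) = Some (C, b)" and v: "valid C b"
      using b unfolding I_def by blast
    have "F b = W C b" using F_eq[OF D] .
    moreover have W: "W C b \<in> H" "W C b \<preceq> C" "compatible b (W C b)" using WL[OF v] unfolding spec_def by blast+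
    moreover have "W C b \<preceq> A" using le_trans[OF W(2)] v W(1) H_subset AinR unfolding valid_def by blast
    ultimately show ?thesis unfolding restr_def compatible_def by auto
  qed
  have "selective H" using selective_coideal unfolding selective_coideal_def by blast
  moreover have "I \<subseteq> AR" unfolding I_def by blast
  ultimately have "\<exists>B \<in> restr H A. \<forall>a \<in> I \<inter> AR_below B. basic a B \<subseteq> basic a (F a)"
    using A F_ok unfolding selective_def by blast
  then obtain D where D: "D \<in> H" "D \<preceq> A"
    and diag: "\<And>b. b \<in> I \<Longrightarrow> b \<in> AR_below D \<Longrightarrow> basic b D \<subseteq> basic b (F b)"
    unfolding restr_def by blast
  have DR: "D \<in> R" using D H_subset by blast
  \<comment> \<open>Here the diagonalisation acts: whenever the state is set, \<open>D\<close> lies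
    below the element prepared for it, so the conclusions of \<open>fusion_step\<close> apply to
    \<open>D\<close> itself.\<close>
  have below: "D \<in> basic (r n D) (W C (r n D))" if "st D n = Some (C, r n D)" "valid C (r n D)" for n C
  proof -
    have "F (r n D) = W C (r n D)" using F_eq[OF DR] that DR by simp
    moreover have "r n D \<in> I" unfolding I_def using that DR by auto
    moreover have "r n D \<in> AR_below D"
      unfolding AR_below_def using DR compatible_r[OF DR DR le_refl[OF DR]] by blast
    moreover have "D \<in> basic (r n D) D" using DR le_refl unfolding basic_def by blast
    ultimately show ?thesis using diag[of "r n D"] by auto
  qed
  \<comment> \<open>Starting only when the depth in \<open>A\<close> reaches \<open>N\<close> makes
    the first frozen length at least \<open>N\<close>; shorter approximations of \<open>D\<close>
    have depth below \<open>N\<close> and are already absorbed by \<open>A\<close>.\<close>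
  define n0 where "n0 = (LEAST n. N \<le> depth A (r n D))"
  have n0: "N \<le> depth A (r n0 D)"
    unfolding n0_def using depth_unbounded[OF DR AinR D(2)] by (rule LeastI_ex)
  have n0_less: "depth A (r n D) < N" if "n < n0" for n
    using that not_less_Least unfolding n0_def by (metis not_le)
  have none: "st D n = None" if "n < n0" for n
    using that
  proof (induction n)
    case 0
    then show ?case using n0_less[of 0] unfolding st_def by simp
  next
    case (Suc n)
    then show ?case using n0_less[of "Suc n"] unfolding st_def by simp
  qed
  have start: "st D n0 = Some (A, r n0 D)"
  proof (cases n0)
    case 0
    then show ?thesis using n0 unfolding st_def by simp
  next
    case (Suc n)
    then show ?thesis using n0 none[of n] unfolding st_def by simp
  qed
  \<comment> \<open>Invariant after reading \<open>r n D\<close>: the next change is due at length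
    \<open>L C b\<close>, still ahead, and \<open>D\<close> lies in the neighbourhood on which
    \<open>spec\<close> speaks.\<close>
  define ok where "ok n C b \<longleftrightarrow> st D n = Some (C, b) \<and> valid C b \<and> len b \<le> n \<and>
    n < L C b \<and> D \<in> basic b (W C b)" for n C b
  have ok_new: "ok n C (r n D)" if "st D n = Some (C, r n D)" "valid C (r n D)" for n C
    using below[OF that] that WL[OF that(2)] DR unfolding ok_def spec_def by simp
  have ok_advances: "advances Q C b (r (L C b) D) (K C b (r (L C b) D))" if "ok n C b" for n C b
  proof -
    have "\<exists>C'. advances Q C b (r (L C b) D) C'" using that WL[of C b] unfolding ok_def spec_def by blast
    then show ?thesis unfolding K_def by (rule someI_ex)
  qed
  have ok_step: "(Suc n \<noteq> L C b \<and> ok (Suc n) C b) \<or>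
      (\<exists>C'. advances Q C b (r (Suc n) D) C' \<and> ok (Suc n) C' (r (Suc n) D))" if o: "ok n C b" for n C b
  proof (cases "Suc n = L C b")
    case True
    define C' where "C' = K C b (r (Suc n) D)"
    have adv: "advances Q C b (r (Suc n) D) C'" using ok_advances[OF o] True unfolding C'_def by simp
    have CR: "C \<in> R" "C \<preceq> A" using o H_subset unfolding ok_def valid_def by blast+
    have "C' \<in> R" "C' \<preceq> C" using adv CR unfolding advances_def by (auto simp: basic_nat_iff)
    then have "valid C' (r (Suc n) D)"
      using adv le_trans[of C' C A] CR AinR DR unfolding advances_def valid_def by auto
    moreover have "st D (Suc n) = Some (C', r (Suc n) D)"
      using o True[symmetric] unfolding ok_def st_def C'_def by simp
    ultimately show ?thesis using ok_new adv by blast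
  next
    case False
    then have "st D (Suc n) = Some (C, b)" using o unfolding ok_def st_def by simp
    then show ?thesis using o False unfolding ok_def by auto
  qed
  define Cs where "Cs n = fst (the (st D (n0 + n)))" for n
  define bs where "bs n = snd (the (st D (n0 + n)))" for n
  define Ms where "Ms n = depth (Cs n) (bs n)" for n
  have ok: "ok (n0 + n) (Cs n) (bs n)" for n
  proof (induction n)
    case 0
    have "valid A (r n0 D)"
      unfolding valid_def using A le_refl[OF AinR] DR compatible_r[OF DR AinR D(2)] by blast
    then show ?case using ok_new[OF start] start unfolding Cs_def bs_def by simp
  next
    case (Suc n)
    then obtain C b where "ok (Suc (n0 + n)) C b" using ok_step by blast
    then show ?case unfolding Cs_def bs_def ok_def by simp
  qed
  have trans: "(L (Cs n) (bs n) \<noteq> Suc (n0 + n) \<and> Cs (Suc n) = Cs n \<and> bs (Suc n) = bs n) \<or>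
      advances Q (Cs n) (bs n) (bs (Suc n)) (Cs (Suc n))" for n
  proof -
    have same: "C = Cs (Suc n) \<and> b = bs (Suc n)" if "ok (Suc (n0 + n)) C b" for C b
      using that unfolding ok_def Cs_def bs_def by simp
    show ?thesis using ok_step[OF ok[of n]] same by metis
  qed
  have CsH: "Cs n \<in> H" "Cs n \<preceq> A" "Cs n \<in> R" for n
    using ok[of n] H_subset unfolding ok_def valid_def by blast+
  have Cs_step: "Cs (Suc n) \<in> basic_nat (Ms n) (Cs n)" for n
    using trans[of n] basic_nat_refl[OF CsH(3)[of n]] unfolding advances_def Ms_def by auto
  have Ms_step: "Ms n \<le> Ms (Suc n)" for n
    using trans[of n] unfolding advances_def Ms_def by auto
  have Ms_mono: "Ms n \<le> Ms m" if "n \<le> m" for n m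
    using Ms_step that by (rule lift_Suc_mono_le)
  have Ms_grow: "\<exists>m. Ms n < Ms m" for n
  proof (rule ccontr)
    assume neg: "\<not> ?thesis"
    have const: "Cs m = Cs n \<and> bs m = bs n" if "n \<le> m" for m
      using that
    proof (induction rule: dec_induct)
      case (step m)
      have "\<not> Ms m < Ms (Suc m)" using neg Ms_mono[of n m] step.hyps by (meson le_less_trans)
      then show ?case using trans[of m] step.IH unfolding advances_def Ms_def by auto
    qed simp
    \<comment> \<open>A constant state would outlive its own deadline: the invariant fails at a
      stage past the length \<open>L (Cs n) (bs n)\<close>.\<close>
    have "n0 + (n + L (Cs n) (bs n)) < L (Cs n) (bs n)"
      using ok[of "n + L (Cs n) (bs n)"] const[of "n + L (Cs n) (bs n)"] unfolding ok_def by simp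
    then show False by simp
  qed
  have unb: "\<exists>n. k \<le> Ms n" for k
  proof (induction k)
    case (Suc k)
    then show ?case using Ms_grow by (meson Suc_leI le_less_trans)
  qed simp
  obtain B where B: "B \<in> R" "\<And>n. B \<in> basic_nat (Ms n) (Cs n)"
    using fusion_limit[of Cs Ms, OF CsH(3) Cs_step Ms_step unb] by blast
  have B_eq: "r i B = r i (Cs n)" if "i \<le> Ms n" for i n
    using B(2)[of n] r_eq_mono[of "Ms n" B "Cs n" i] that B(1) CsH(3) by (simp add: basic_nat_iff)
  have C0: "Cs 0 = A" "Ms 0 = depth A (r n0 D)"
    using start unfolding Cs_def bs_def Ms_def by auto
  \<comment> \<open>\<open>B\<close> agrees with \<open>Cs n\<close> up to \<open>Ms n\<close>, so
    whatever is absorbed within that length is absorbed by \<open>B\<close>.\<close>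
  have low: "\<exists>k. r i D \<preceq>\<^sub>f r k B" if "depth (Cs n) (r i D) \<le> Ms n" "D \<preceq> Cs n" for i n
    using depth_lefin[of "r i D" "Cs n"] compatible_r[OF DR CsH(3) that(2)] B_eq[OF that(1)] DR CsH(3) r_in_AR
    by metis
  have "D \<preceq> B"
    unfolding A4_le[OF DR B(1)]
  proof
    fix i
    show "\<exists>k. r i D \<preceq>\<^sub>f r k B"
    proof (cases "i < n0")
      case True
      then show ?thesis using low[where i = i and n = 0] n0_less[OF True] n0 C0 D(2) by simp
    next
      case False
      then obtain n where i: "i = n0 + n" by (metis le_Suc_ex not_less)
      have o: "valid (Cs n) (bs n)" "len (bs n) \<le> i" "i < L (Cs n) (bs n)" "D \<in> basic (bs n) (W (Cs n) (bs n))"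
        using ok[of n] i unfolding ok_def by auto
      have W: "W (Cs n) (bs n) \<in> R" "W (Cs n) (bs n) \<preceq> Cs n"
        using WL[OF o(1)] H_subset unfolding spec_def by blast+
      have "D \<preceq> W (Cs n) (bs n)" using o(4) unfolding basic_def by blast
      then have "D \<preceq> Cs n" using le_trans W DR CsH(3) by blast
      moreover have "depth (Cs n) (r i D) \<le> Ms n"
        using WL[OF o(1)] o(2-4) unfolding spec_def Ms_def by blast
      ultimately show ?thesis using low by blast
    qed
  qed
  then have BH: "B \<in> H" using H_upward[OF D(1)] B(1) by blast
  \<comment> \<open>The intervals from \<open>Ms n\<close> to \<open>Ms (Suc n)\<close> cover all
    levels from \<open>Ms 0\<close> on, and a nonempty one comes from an advance, which treats its
    levels.\<close>
  have "Q j B" if j: "Ms 0 \<le> j" for j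
  proof -
    obtain n where "j < Ms n" using unb[of "Suc j"] by (auto simp: Suc_le_eq)
    then have "\<exists>n. j < Ms (Suc n) \<and> Ms n \<le> j"
    proof (induction n)
      case 0
      then show ?case using j by simp
    next
      case (Suc n)
      then show ?case by (cases "Ms n \<le> j") auto
    qed
    then obtain n where n: "j < Ms (Suc n)" "Ms n \<le> j" by blast
    then have "advances Q (Cs n) (bs n) (bs (Suc n)) (Cs (Suc n))"
      using trans[of n] unfolding Ms_def by auto
    then have "Q j (Cs (Suc n))" using n unfolding advances_def Ms_def by blast
    moreover have "B \<in> basic_nat j (Cs (Suc n))"
      using basic_nat_antimono[OF CsH(3) B(2)[of "Suc n"]] n by simp
    ultimately show ?thesis using hered CsH BH by blast
  qed
  then show thesis using that[of "Ms 0" B] n0 BH B(2)[of 0] C0 by simp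
qed

text \<open>Level \<open>j\<close> is treated when every approximation of depth \<open>j\<close>
  satisfies \<open>P\<close>. There are finitely many of these, so they can be handled one after
  another.\<close>

lemma fusion_pointwise:
  assumes A: "A \<in> H"
    and step: "\<And>C c. C \<in> H \<Longrightarrow> C \<preceq> A \<Longrightarrow> c \<in> AR \<Longrightarrow> compatible c C \<Longrightarrow>
      \<exists>C'\<in>H. C' \<in> basic_nat (depth C c) C \<and> P c C'"
    and hered: "\<And>C C' c. P c C \<Longrightarrow> c \<in> AR \<Longrightarrow> C \<in> H \<Longrightarrow> C \<preceq> A \<Longrightarrow> C' \<in> H \<Longrightarrow> C' \<preceq> C \<Longrightarrow> P c C'"
  obtains m B where "N \<le> m" "B \<in> H" "B \<in> basic_nat m A"
    "\<And>c. c \<in> AR \<Longrightarrow> compatible c B \<Longrightarrow> m \<le> depth B c \<Longrightarrow> P c B"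
proof -
  have AinR: "A \<in> R" using A H_subset by blast
  define Q where "Q j C \<longleftrightarrow> (\<forall>c\<in>AR. compatible c C \<longrightarrow> depth C c = j \<longrightarrow> P c C)" for j C
  \<comment> \<open>Passing to a member of \<open>basic_nat j C\<close> creates no new
    approximations of depth \<open>j\<close>, so the finite list fixed at the start remains
    complete.\<close>
  have pull: "compatible c C \<and> depth C c = j"
    if "c \<in> AR" "C \<in> R" "C' \<in> basic_nat j C" "compatible c C'" "depth C' c = j" for c C C' j
  proof -
    have C': "C' \<in> R" "r j C' = r j C" "C' \<preceq> C" using that basic_nat_iff by auto
    then show ?thesis
      using compatible_mono[OF that(4)] depth_cong[OF that(1) C'(1) that(2,4) C'(2)] that by simp
  qed
  have Q_hered: "Q j C'" if "Q j C" "C \<in> H" "C \<preceq> A" "C' \<in> H" "C' \<in> basic_nat j C" for j C C'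
    unfolding Q_def
  proof (intro ballI impI)
    fix c assume c: "c \<in> AR" "compatible c C'" "depth C' c = j"
    have CR: "C \<in> R" using that H_subset by blast
    then have "P c C" using pull[OF c(1) CR that(5) c(2,3)] that(1) c(1) unfolding Q_def by blast
    moreover have "C' \<preceq> C" using that(5) CR by (simp add: basic_nat_iff)
    ultimately show "P c C'" using hered that c by blast
  qed
  have Q_step: "\<exists>C'\<in>H. C' \<in> basic_nat j C \<and> Q j C'" if C: "C \<in> H" "C \<preceq> A" for j C
  proof -
    have CR: "C \<in> R" using C H_subset by blast
    have "\<exists>C'\<in>H. C' \<in> basic_nat j C \<and> (\<forall>c\<in>S. compatible c C' \<longrightarrow> depth C' c = j \<longrightarrow> P c C')"
      if "finite S" "S \<subseteq> AR" for S
      using that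
    proof (induction)
      case empty
      then show ?case using C basic_nat_refl[OF CR] by blast
    next
      case (insert c S)
      then obtain C1 where C1: "C1 \<in> H" "C1 \<in> basic_nat j C"
        "\<forall>c\<in>S. compatible c C1 \<longrightarrow> depth C1 c = j \<longrightarrow> P c C1" by blast
      have C1R: "C1 \<in> R" "C1 \<preceq> C" using C1(2) CR by (simp_all add: basic_nat_iff)
      then have C1A: "C1 \<preceq> A" using le_trans C CR AinR by blast
      show ?case
      proof (cases "compatible c C1 \<and> depth C1 c = j")
        case True
        then obtain C2 where C2: "C2 \<in> H" "C2 \<in> basic_nat j C1" "P c C2"
          using step[OF C1(1) C1A] insert.prems by blast
        have "C2 \<preceq> C1" using C2(2) C1R by (simp add: basic_nat_iff)
        have "P e C2" if e: "e \<in> S" "compatible e C2" "depth C2 e = j" for e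
        proof -
          have "e \<in> AR" using e(1) insert.prems by blast
          then have "P e C1" using pull[OF _ C1R(1) C2(2) e(2,3)] C1(3) e(1) by blast
          then show ?thesis using hered \<open>e \<in> AR\<close> C1(1) C1A C2(1) \<open>C2 \<preceq> C1\<close> by blast
        qed
        moreover have "C2 \<in> basic_nat j C" using basic_nat_trans[OF CR C1(2) C2(2)] by simp
        ultimately show ?thesis using C2 by blast
      next
        case False
        then show ?thesis using C1 by blast
      qed
    qed
    from this[OF finite_depth_le[OF CR, of j]]
    obtain C' where C': "C' \<in> H" "C' \<in> basic_nat j C"
      "\<forall>c\<in>AR. compatible c C \<and> depth C c \<le> j \<longrightarrow> compatible c C' \<longrightarrow> depth C' c = j \<longrightarrow> P c C'"
      by blast
    have "Q j C'" unfolding Q_def using C'(3) pull[OF _ CR C'(2)] by (metis order_refl)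
    then show ?thesis using C' by blast
  qed
  show thesis
  proof (rule fusion[OF A, where Q = Q and N = N])
    fix m B assume "N \<le> m" "B \<in> H" "B \<in> basic_nat m A" "\<And>j. m \<le> j \<Longrightarrow> Q j B"
    then show thesis using that unfolding Q_def by blast
  qed (fact Q_step, fact Q_hered)
qed

section \<open>Combinatorial forcing\<close>

text \<open>Rejection in the sense of Galvin-Prikry combinatorial forcing, relative to
  \<open>H\<close>; acceptance is \<open>basic b C \<subseteq> X\<close>. Compatibility is demanded
  because an empty \<open>basic b E\<close> would accept vacuously.\<close>

definition rejects :: "'r set \<Rightarrow> 'a \<Rightarrow> 'r \<Rightarrow> bool" where
  "rejects X b C \<longleftrightarrow> (\<forall>E\<in>H. E \<preceq> C \<longrightarrow> compatible b E \<longrightarrow> \<not> basic b E \<subseteq> X)"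

definition decides :: "'r set \<Rightarrow> 'a \<Rightarrow> 'r \<Rightarrow> bool" where
  "decides X b C \<longleftrightarrow> basic b C \<subseteq> X \<or> rejects X b C"

lemma rejects_mono: "rejects X b C \<Longrightarrow> C' \<preceq> C \<Longrightarrow> C \<in> R \<Longrightarrow> C' \<in> R \<Longrightarrow> rejects X b C'"
  unfolding rejects_def using le_trans H_subset by blast

lemma decides_mono: "decides X b C \<Longrightarrow> C' \<preceq> C \<Longrightarrow> C \<in> R \<Longrightarrow> C' \<in> R \<Longrightarrow> decides X b C'"
  unfolding decides_def using rejects_mono basic_mono by blast

lemma rejects_not_accepts:
  "rejects X b C \<Longrightarrow> C \<in> H \<Longrightarrow> compatible b C \<Longrightarrow> \<not> basic b C \<subseteq> X"
  unfolding rejects_def using le_refl H_subset by blast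

text \<open>If \<open>C\<close> does not reject \<open>c\<close>, some \<open>E\<close> below
  \<open>C\<close> accepts it. Such an \<open>E\<close> need not agree with \<open>C\<close> up to
  the depth of \<open>c\<close>, so amalgamation carries the acceptance into
  \<open>basic_nat (depth C c) C\<close>.\<close>

lemma ex_decides:
  assumes "C \<in> H" "c \<in> AR" "compatible c C"
  shows "\<exists>C'\<in>H. C' \<in> basic_nat (depth C c) C \<and> decides X c C'"
proof (cases "rejects X c C")
  case True
  then show ?thesis using assms basic_nat_refl H_subset unfolding decides_def by blast
next
  case False
  then obtain E where E: "E \<in> H" "E \<preceq> C" "compatible c E" "basic c E \<subseteq> X"
    unfolding rejects_def by blast
  obtain W where W: "W \<in> H" "W \<in> basic c E" using H_meets_basic[OF E(1) assms(2) E(3)] by blast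
  have "W \<in> basic c C" using W(2) basic_mono[OF E(2)] E(1) assms(1) H_subset by blast
  then obtain C' where C': "C' \<in> H" "C' \<in> basic_nat (depth C c) C" "basic c C' \<subseteq> basic c W"
    using H_amalgamation[OF assms(1,2) _ W(1)] by blast
  have "W \<preceq> E" using W(2) unfolding basic_def by blast
  then have "basic c W \<subseteq> basic c E" using basic_mono W(1) E(1) H_subset by blast
  then show ?thesis using C' E(4) unfolding decides_def by blast
qed

text \<open>After the two fusions and the escape from small depths, the first approximation past
  \<open>c\<close> settles everything: if it is accepted, membership in \<open>X\<close> follows at
  once; if it is rejected, rejection persists along the whole branch, which openness of
  \<open>X\<close> forbids for members of \<open>X\<close>.\<close>

lemma open_dichotomy:
  assumes X: "metric_open X" and a: "a \<in> AR" and A: "A \<in> H" "compatible a A"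
  shows "\<exists>D\<in>H. D \<preceq> A \<and> compatible a D \<and> (basic a D \<subseteq> X \<or> basic a D \<subseteq> R - X)"
proof -
  have AinR: "A \<in> R" using A H_subset by blast
  obtain m1 B1 where m1: "depth A a \<le> m1" and B1: "B1 \<in> H" "B1 \<in> basic_nat m1 A"
    and dec: "\<And>c. c \<in> AR \<Longrightarrow> compatible c B1 \<Longrightarrow> m1 \<le> depth B1 c \<Longrightarrow> decides X c B1"
  proof (rule fusion_pointwise[OF A(1), where P = "decides X" and N = "depth A a"])
    show "\<exists>C'\<in>H. C' \<in> basic_nat (depth C c) C \<and> decides X c C'"
      if "C \<in> H" "c \<in> AR" "compatible c C" for C c
      using that by (rule ex_decides)
    show "decides X c C'" if "decides X c C" "C \<in> H" "C' \<in> H" "C' \<preceq> C" for C C' c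
      using that decides_mono H_subset by blast
  qed blast
  have B1R: "B1 \<in> R" "B1 \<preceq> A" using B1(2) AinR by (simp_all add: basic_nat_iff)
  define low where "low c \<longleftrightarrow> depth B1 c < m1" for c
  \<comment> \<open>\<open>B1\<close> decides approximations of large depth only, hence the clause
    \<open>low\<close>. It refers to the fixed \<open>B1\<close>, and is excluded in the end by
    avoiding \<open>T\<close>.\<close>
  define P where "P c C \<longleftrightarrow> (\<not> low c \<longrightarrow> rejects X c C \<longrightarrow>
    (\<forall>E\<in>basic c C. low (r (Suc (len c)) E) \<or> rejects X (r (Suc (len c)) E) C))" for c C
  have dec': "decides X c C" if "c \<in> AR" "\<not> low c" "C \<in> H" "C \<preceq> B1" "compatible c C" for c C
    using dec[of c] decides_mono[of X c B1 C] compatible_mono[of c C B1] that B1R H_subset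
    unfolding low_def by simp
  have P_hered: "P c C'" if "P c C" "c \<in> AR" "C \<in> H" "C \<preceq> B1" "C' \<in> H" "C' \<preceq> C" for c C C'
    unfolding P_def
  proof (intro impI ballI)
    fix E assume c: "\<not> low c" "rejects X c C'" and E: "E \<in> basic c C'"
    have R: "C \<in> R" "C' \<in> R" using that H_subset by auto
    have cC': "compatible c C'" using E unfolding compatible_def by blast
    have sub: "basic c C' \<subseteq> basic c C" using basic_mono that R by blast
    \<comment> \<open>Rejection by \<open>C'\<close> has to be lifted to the larger
      \<open>C\<close>: since \<open>C\<close> decides \<open>c\<close>, it would otherwise accept,
      and \<open>C'\<close> would inherit the acceptance.\<close>
    have "\<not> basic c C \<subseteq> X" using rejects_not_accepts[OF c(2) that(5) cC'] sub by blast
    moreover have "decides X c C"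
      using dec'[OF that(2) c(1) that(3,4)] compatible_mono[OF cC' that(6) R] by blast
    ultimately have "rejects X c C" unfolding decides_def by blast
    then have "low (r (Suc (len c)) E) \<or> rejects X (r (Suc (len c)) E) C"
      using that(1) c(1) E sub unfolding P_def by blast
    then show "low (r (Suc (len c)) E) \<or> rejects X (r (Suc (len c)) E) C'"
      using rejects_mono that(6) R by blast
  qed
  have P_step: "\<exists>C'\<in>H. C' \<in> basic_nat (depth C c) C \<and> P c C'"
    if C: "C \<in> H" "C \<preceq> B1" and c: "c \<in> AR" "compatible c C" for C c
  proof (cases "\<not> low c \<and> rejects X c C")
    case False
    then show ?thesis using C basic_nat_refl H_subset unfolding P_def by blast
  next
    case True
    have CR: "C \<in> R" using C H_subset by blast
    obtain B where B: "B \<in> H" "B \<in> basic_nat (depth C c) C" "compatible c B" "B \<preceq> C"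
      and dich: "(\<forall>E\<in>basic c B. low (r (Suc (len c)) E) \<or> rejects X (r (Suc (len c)) E) C) \<or>
        (\<forall>E\<in>basic c B. \<not> (low (r (Suc (len c)) E) \<or> rejects X (r (Suc (len c)) E) C))"
      using H_pigeonhole[OF C(1) c, of "\<lambda>x. low x \<or> rejects X x C"] by metis
    have BR: "B \<in> R" using B H_subset by blast
    show ?thesis
    proof (cases "\<forall>E\<in>basic c B. low (r (Suc (len c)) E) \<or> rejects X (r (Suc (len c)) E) C")
      case True
      then have "P c B" unfolding P_def using rejects_mono B(4) BR CR by blast
      then show ?thesis using B by blast
    next
      case False
      \<comment> \<open>In the other alternative all successors of \<open>c\<close> are accepted, so
        \<open>B\<close> accepts \<open>c\<close>, against its rejection by
        \<open>C\<close>.\<close>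
      have "basic c B \<subseteq> X"
      proof
        fix E assume E: "E \<in> basic c B"
        define x where "x = r (Suc (len c)) E"
        have ER: "E \<in> R" "E \<preceq> C"
          using E basic_mono[OF B(4) CR BR] unfolding basic_def by blast+
        have x: "\<not> low x" "\<not> rejects X x C" using False dich E unfolding x_def by blast+
        have "decides X x C"
          using dec'[OF _ x(1) C] compatible_r[OF ER(1) CR ER(2)] ER(1) unfolding x_def by blast
        then have "basic x C \<subseteq> X" using x(2) unfolding decides_def by blast
        moreover have "E \<in> basic x C" using ER unfolding x_def basic_def by blast
        ultimately show "E \<in> X" by blast
      qed
      then have "\<not> rejects X c C" using B unfolding rejects_def by blast
      then show ?thesis using True by blast
    qed
  qed
  obtain m2 B2 where m2: "m1 \<le> m2" and B2: "B2 \<in> H" "B2 \<in> basic_nat m2 B1"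
    and P: "\<And>c. c \<in> AR \<Longrightarrow> compatible c B2 \<Longrightarrow> m2 \<le> depth B2 c \<Longrightarrow> P c B2"
  proof (rule fusion_pointwise[OF B1(1), where P = P and N = m1])
    show "\<exists>C'\<in>H. C' \<in> basic_nat (depth C c) C \<and> P c C'"
      if "C \<in> H" "C \<preceq> B1" "c \<in> AR" "compatible c C" for C c
      using that by (rule P_step)
    show "P c C'" if "P c C" "c \<in> AR" "C \<in> H" "C \<preceq> B1" "C' \<in> H" "C' \<preceq> C" for C C' c
      using that by (rule P_hered)
  qed blast
  have B2R: "B2 \<in> R" "B2 \<preceq> B1" using B2(2) B1R by (simp_all add: basic_nat_iff)
  have B2A: "B2 \<preceq> A" using le_trans B2R B1R AinR by blast
  have "B2 \<in> basic_nat m1 A" using basic_nat_trans[OF AinR B1(2) B2(2), of m1] m2 by simp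
  then have aB2: "compatible a B2" using compatible_basic_nat[OF a AinR A(2) _ m1] by blast
  define T where "T = {c \<in> AR. compatible c B2 \<and> depth B2 c \<le> m2}"
  have T: "finite T" "T \<subseteq> AR" using finite_depth_le[OF B2R(1)] unfolding T_def by auto
  \<comment> \<open>A depth below \<open>m1\<close> in \<open>B1\<close> is also the depth in
    \<open>B2\<close>, because the two agree up to \<open>m2\<close>; so \<open>c\<close> would be
    in \<open>T\<close>.\<close>
  have high: "\<not> low c" if c: "c \<in> AR" "compatible c B2" "c \<notin> T" for c
  proof
    assume "low c"
    moreover have "compatible c B1" using compatible_mono c B2R B1R by blast
    moreover have "r m2 B1 = r m2 B2" using B2(2) B1R by (simp add: basic_nat_iff)
    ultimately have "depth B2 c = depth B1 c"
      using depth_cong[OF c(1) B1R(1) B2R(1)] m2 unfolding low_def by simp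
    then show False using \<open>low c\<close> c m2 unfolding low_def T_def by simp
  qed
  obtain D1 c where D1: "D1 \<in> H" "D1 \<preceq> B2" "compatible a D1" "c \<in> insert a T" "len a \<le> len c"
    and through: "\<And>E. E \<in> basic a D1 \<Longrightarrow> r (len c) E = c"
    and escape: "\<And>E n. E \<in> basic a D1 \<Longrightarrow> len c < n \<Longrightarrow> r n E \<notin> T"
    using escape_finite[OF T a B2(1) aB2] by blast
  have D1R: "D1 \<in> R" using D1 H_subset by blast
  have c: "c \<in> AR" using D1(4) T a by blast
  obtain E0 where E0: "E0 \<in> basic a D1" using D1(3) unfolding compatible_def by blast
  then have "E0 \<in> basic c D1" using through[OF E0] a c by (simp add: basic_iff)
  then have "compatible c D1" unfolding compatible_def by blast
  then obtain D where D: "D \<in> H" "compatible c D" "D \<preceq> D1"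
    and dich: "(\<forall>E\<in>basic c D. rejects X (r (Suc (len c)) E) B2) \<or>
      (\<forall>E\<in>basic c D. \<not> rejects X (r (Suc (len c)) E) B2)"
    using H_pigeonhole[OF D1(1) c, of "\<lambda>x. rejects X x B2"] by metis
  have DR: "D \<in> R" using D H_subset by blast
  have DB2: "D \<preceq> B2" using le_trans[OF D(3) D1(2)] DR D1R B2R by blast
  have aD: "compatible a D"
    using compatible_initial[OF D(2) c _ through[OF E0] D1(5)] E0 a by (auto simp: basic_iff)
  have inD: "E \<in> R \<and> E \<preceq> B2 \<and> E \<in> basic a D1 \<and> E \<in> basic c D" if "E \<in> basic a D" for E
  proof -
    have E: "E \<in> R" "E \<preceq> D" using that unfolding basic_def by blast+
    have E1: "E \<in> basic a D1" using that basic_mono[OF D(3) D1R DR] by blast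
    then show ?thesis using E through[OF E1] c le_trans[OF E(2) DB2] DR B2R by (simp add: basic_iff)
  qed
  have comp: "compatible (r n E) B2" "r n E \<in> AR" if "E \<in> basic a D" for E n
    using inD[OF that] compatible_r B2R by blast+
  have dec2: "\<not> low (r n E)" "decides X (r n E) B2" "m2 \<le> depth B2 (r n E)"
    if E: "E \<in> basic a D" "len c < n" for E n
  proof -
    have "r n E \<notin> T" using escape inD E by blast
    then show "\<not> low (r n E)" "m2 \<le> depth B2 (r n E)"
      using high comp[OF E(1)] unfolding T_def by auto
    then show "decides X (r n E) B2" using dec' comp[OF E(1)] B2 B2R by blast
  qed
  have "basic a D \<subseteq> X \<or> basic a D \<subseteq> R - X"
  proof (cases "\<forall>E\<in>basic c D. rejects X (r (Suc (len c)) E) B2")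
    case False
    have "E \<in> X" if E: "E \<in> basic a D" for E
    proof -
      have "\<not> rejects X (r (Suc (len c)) E) B2" using False dich inD[OF E] by blast
      then have "basic (r (Suc (len c)) E) B2 \<subseteq> X" using dec2(2)[OF E] unfolding decides_def by blast
      moreover have "E \<in> basic (r (Suc (len c)) E) B2" using inD[OF E] unfolding basic_def by blast
      ultimately show ?thesis by blast
    qed
    then show ?thesis by blast
  next
    case True
    have "E \<notin> X" if E: "E \<in> basic a D" for E
    proof
      assume "E \<in> X"
      then obtain n where n: "\<And>m E'. n \<le> m \<Longrightarrow> E' \<in> R \<Longrightarrow> r m E' = r m E \<Longrightarrow> E' \<in> X"
        using metric_open_nbhd[OF X] by blast
      have rej: "rejects X (r (Suc (len c) + k) E) B2" for k
      proof (induction k)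
        case 0
        then show ?case using True inD[OF E] by simp
      next
        case (Suc k)
        define x where "x = r (Suc (len c) + k) E"
        have x: "x \<in> AR" "compatible x B2" "\<not> low x" "m2 \<le> depth B2 x" "len x = Suc (len c) + k"
          using comp[OF E] dec2[OF E] inD[OF E] unfolding x_def by auto
        have "E \<in> basic x B2" using inD[OF E] unfolding x_def basic_def by blast
        then have "low (r (Suc (len x)) E) \<or> rejects X (r (Suc (len x)) E) B2"
          using P[OF x(1,2,4)] x(3) Suc.IH unfolding P_def x_def[symmetric] by blast
        then show ?case using dec2(1)[OF E, of "Suc (len x)"] x(5) by simp
      qed
      have ER: "E \<in> R" using inD[OF E] by blast
      \<comment> \<open>The index \<open>n\<close> takes the approximation past the length fixed by
        openness: all members of \<open>R\<close> through it are in \<open>X\<close>, so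
        \<open>B2\<close> accepts what it was shown to reject.\<close>
      have "basic (r (Suc (len c) + n) E) B2 \<subseteq> X"
        using n[of "Suc (len c) + n"] comp(2)[OF E] ER by (auto simp: basic_iff)
      then show False using rejects_not_accepts[OF rej B2(1) comp(1)[OF E]] by blast
    qed
    then show ?thesis using inD by blast
  qed
  moreover have "D \<preceq> A" using le_trans[OF DB2 B2A] DR B2R AinR by blast
  ultimately show ?thesis using D(1) aD by blast
qed

text \<open>The homogeneous \<open>D\<close> need not itself pass through \<open>a\<close>; a member
  of \<open>H\<close> in \<open>basic a D\<close> does, and it inherits homogeneity.\<close>

lemma metric_open_H_Ramsey:
  assumes "metric_open X"
  shows "H_Ramsey H X"
  unfolding H_Ramsey_def
proof (intro ballI impI)
  fix a A assume a: "a \<in> AR" and A: "A \<in> H" "basic a A \<noteq> {}"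
  then obtain D where D: "D \<in> H" "D \<preceq> A" "compatible a D" "basic a D \<subseteq> X \<or> basic a D \<subseteq> R - X"
    using open_dichotomy[OF assms a A(1)] unfolding compatible_def by blast
  obtain B where B: "B \<in> H" "B \<in> basic a D" using H_meets_basic[OF D(1) a D(3)] by blast
  have R: "A \<in> R" "D \<in> R" "B \<in> R" using A D B H_subset by auto
  have "B \<in> basic a A" using B(2) basic_mono[OF D(2)] R by blast
  moreover have "B \<preceq> D" using B(2) unfolding basic_def by blast
  then have "basic a B \<subseteq> basic a D" using basic_mono R by blast
  moreover have "B \<in> basic a B" using B(2) le_refl R unfolding basic_def by blast
  ultimately show "\<exists>B\<in>basic a A \<inter> H. basic a B \<noteq> {} \<and> (basic a B \<subseteq> X \<or> basic a B \<subseteq> R - X)"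
    using B(1) D(4) by blast
qed

end

theorem mainTheorem5:
  fixes R :: "'r set"
    and le :: "'r \<Rightarrow> 'r \<Rightarrow> bool"
    and r :: "nat \<Rightarrow> 'r \<Rightarrow> 'a"
    and lefin :: "'a \<Rightarrow> 'a \<Rightarrow> bool"
    and emp :: 'a
    and H :: "'r set"
  assumes "topological_Ramsey_space R le r lefin emp"
    and "ramsey_triple.selective_coideal R le r lefin H"
  shows "\<forall>X. ramsey_triple.metric_open R r X \<longrightarrow> ramsey_triple.H_Ramsey R le r H X"
proof -
  interpret selective_coideal_in_space R le r lefin emp H
    using assms by (intro selective_coideal_in_space.intro selective_coideal_in_space_axioms.intro)
  show ?thesis using metric_open_H_Ramsey by blast
qed

end
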